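(* Let $n\in\mathbb{N}$ and let $\mathbf{x}=(x_1,\dots,x_n)\in\{-1,0,1\}^n$ satisfy $\|\mathbf{x}\|_{BV}>0$ (i.e. $\mathbf{x}$ is not constant). Then $$\|\mathbf{x}\|_1\le\|\mathbf{x}\|_D\cdot\|\mathbf{x}\|_{BV}.$$
   Context: For $\mathbf{x}=(x_1,\dots,x_n)\in\mathbb{R}^n$: $\|\mathbf{x}\|_1=\sum_{i=1}^n|x_i|$; the discrepancy norm is $\|\mathbf{x}\|_D=\max_{1\le n_1\le n_2\le n}\left|\sum_{i=n_1}^{n_2}x_i\right|$; the total variation is $\|\mathbf{x}\|_{BV}=\sum_{i=1}^{n-1}|x_{i+1}-x_i|$. *)

theory Defs
  imports Complex_Main
begin

text \<open>
  A vector \<open>(x\<^sub>1, \<dots>, x\<^sub>n)\<close> is a function \<open>x :: nat \<Rightarrow> real\<close> together with its length \<open>n\<close>;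
  only the values at the indices \<open>1, \<dots>, n\<close> are used below.
\<close>

definition l1_norm :: "nat \<Rightarrow> (nat \<Rightarrow> real) \<Rightarrow> real" where
  "l1_norm n x = (\<Sum>i = 1..n. \<bar>x i\<bar>)"

text \<open>For \<open>n = 0\<close> the maximum below is over the empty set and hence unspecified.\<close>

definition discrepancy_norm :: "nat \<Rightarrow> (nat \<Rightarrow> real) \<Rightarrow> real" where
  "discrepancy_norm n x =
     Max {\<bar>\<Sum>i = n1..n2. x i\<bar> | n1 n2. 1 \<le> n1 \<and> n1 \<le> n2 \<and> n2 \<le> n}"

text \<open>The truncated subtraction is harmless: for \<open>n \<le> 1\<close> the sum is empty.\<close>

definition total_variation :: "nat \<Rightarrow> (nat \<Rightarrow> real) \<Rightarrow> real" where
  "total_variation n x = (\<Sum>i = 1..n - 1. \<bar>x (i + 1) - x i\<bar>)"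

end

theory Submission imports Defs begin

text \<open>
  Scan the vector from left to right. Each maximal constant nonzero block has \<open>\<ell>\<^sub>1\<close>-mass equal to
  the absolute value of its sum, hence at most the discrepancy norm \<open>D\<close>. So it suffices that, once
  a jump has occurred, the mass before the current block is at most \<open>D\<close> times the variation minus
  the modulus of the current value: this leaves one unit of variation to pay for the current
  block if it is nonzero. The next jump restores the reserve, because \<open>\<bar>y - x\<bar> \<ge> 1 \<ge> \<bar>y\<bar>\<close> for
  distinct \<open>x, y \<in> {-1, 0, 1}\<close>.
\<close>

lemma abs_interval_sum_le_discrepancy_norm:
  assumes "1 \<le> a" "a \<le> b" "b \<le> n"
  shows "\<bar>\<Sum>i = a..b. x i\<bar> \<le> discrepancy_norm n x"
proof -
  let ?S = "{\<bar>\<Sum>i = n1..n2. x i\<bar> | n1 n2. 1 \<le> n1 \<and> n1 \<le> n2 \<and> n2 \<le> n}"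
  have "?S \<subseteq> (\<lambda>(a, b). \<bar>\<Sum>i = a..b. x i\<bar>) ` ({..n} \<times> {..n})"
    by force
  then have "finite ?S"
    by (rule finite_subset) simp
  then show ?thesis
    unfolding discrepancy_norm_def using assms by (intro Max_ge) auto
qed

lemma total_variation_Suc:
  "m \<ge> 1 \<Longrightarrow> total_variation (Suc m) x = total_variation m x + \<bar>x (Suc m) - x m\<bar>"
  by (cases m) (simp_all add: total_variation_def)

lemma total_variation_const:
  assumes "\<And>i. i \<in> {1..n} \<Longrightarrow> x i = c"
  shows "total_variation n x = 0"
  unfolding total_variation_def using assms by (intro sum.neutral) auto

text \<open>Entries of a constant block share one sign, so no cancellation occurs in the block sum.
  The factor \<open>\<bar>c\<bar>\<close> makes a zero block free of charge.\<close>

lemma l1_norm_const_block: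
  assumes "1 \<le> s" "s \<le> m" "m \<le> n"
    and "c \<in> {-1, 0, 1}"
    and const: "\<And>i. i \<in> {s..m} \<Longrightarrow> x i = c"
  shows "l1_norm m x \<le> l1_norm (s - 1) x + discrepancy_norm n x * \<bar>c\<bar>"
proof -
  have "{1..m} = {1..s - 1} \<union> {s..m}"
    using assms(1,2) by auto
  then have "l1_norm m x = l1_norm (s - 1) x + (\<Sum>i = s..m. \<bar>x i\<bar>)"
    unfolding l1_norm_def using assms(1) by (subst sum.union_disjoint[symmetric]) auto
  also have "(\<Sum>i = s..m. \<bar>x i\<bar>) = (\<Sum>i = s..m. \<bar>c\<bar>)"
    using const by (intro sum.cong) auto
  also have "\<dots> = real (Suc m - s) * \<bar>c\<bar>"
    by simp
  also have "\<dots> \<le> discrepancy_norm n x * \<bar>c\<bar>"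
  proof -
    have "(\<Sum>i = s..m. x i) = (\<Sum>i = s..m. c)"
      using const by (intro sum.cong) auto
    then have "\<bar>\<Sum>i = s..m. x i\<bar> = real (Suc m - s) * \<bar>c\<bar>"
      by (simp add: abs_mult)
    then have "real (Suc m - s) * \<bar>c\<bar> \<le> discrepancy_norm n x"
      using abs_interval_sum_le_discrepancy_norm[OF assms(1-3), of x] by simp
    then show ?thesis
      using assms(4) by auto
  qed
  finally show ?thesis by simp
qed

text \<open>Invariant of the scan: \<open>s\<close> marks the start of the current block. The
  alternative \<open>s = 1\<close> covers the time before the first jump, when no variation is
  available as a reserve.\<close>

lemma last_block_l1_bound:
  assumes "1 \<le> m" "m \<le> n"
    and vals: "\<And>i. i \<in> {1..n} \<Longrightarrow> x i \<in> {-1, 0, 1}"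
  shows "\<exists>s. 1 \<le> s \<and> s \<le> m \<and> (\<forall>i\<in>{s..m}. x i = x m) \<and>
    (s = 1 \<or> l1_norm (s - 1) x \<le> discrepancy_norm n x * (total_variation m x - \<bar>x m\<bar>))"
  using assms(1,2)
proof (induction m rule: dec_induct)
  case base
  show ?case by (intro exI[of _ 1]) auto
next
  case (step m)
  let ?D = "discrepancy_norm n x" and ?V = "total_variation m x"
  obtain s where s: "1 \<le> s" "s \<le> m" "\<And>i. i \<in> {s..m} \<Longrightarrow> x i = x m"
    and bound: "s = 1 \<or> l1_norm (s - 1) x \<le> ?D * (?V - \<bar>x m\<bar>)"
    using step.IH step.prems by (metis Suc_leD)
  have V: "total_variation (Suc m) x = ?V + \<bar>x (Suc m) - x m\<bar>"
    using step.hyps by (simp add: total_variation_Suc)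
  show ?case
  proof (cases "x (Suc m) = x m")
    case True
    then have "\<forall>i\<in>{s..Suc m}. x i = x (Suc m)"
      using s(3) by (metis atLeastAtMost_iff le_Suc_eq)
    moreover have "s \<le> Suc m"
      using s(2) by simp
    ultimately show ?thesis
      using s(1) bound True V by (intro exI[of _ s]) simp
  next
    case False
    have x_m: "x m \<in> {-1, 0, 1}" and x_Suc: "x (Suc m) \<in> {-1, 0, 1}"
      using vals step.hyps step.prems by auto
    \<comment> \<open>The one-entry interval at index 1 is a witness, available because
      \<open>n\<close> is positive.\<close>
    have D: "?D \<ge> 0"
      using abs_interval_sum_le_discrepancy_norm[of 1 1 n x] step.prems by simp
    have block: "l1_norm m x \<le> l1_norm (s - 1) x + ?D * \<bar>x m\<bar>"
      using step.prems by (intro l1_norm_const_block s x_m) auto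
    have V0: "?V \<ge> 0"
      unfolding total_variation_def by (rule sum_nonneg) simp
    \<comment> \<open>The jump opens a new block at \<open>Suc m\<close>, so all of
      \<open>l1_norm m x\<close> is now mass before the current block.\<close>
    have "l1_norm m x \<le> ?D * (total_variation (Suc m) x - \<bar>x (Suc m)\<bar>)"
      using bound
    proof
      assume "s = 1"
      then have "l1_norm m x \<le> ?D * \<bar>x m\<bar>"
        using block by (simp add: l1_norm_def)
      \<comment> \<open>Distinct u, v in {-1, 0, 1} satisfy
        \<open>\<bar>v - u\<bar> = \<bar>u\<bar> + \<bar>v\<bar>\<close>: the first jump pays for
        the initial block and also sets up the reserve.\<close>
      also have "\<dots> \<le> ?D * (total_variation (Suc m) x - \<bar>x (Suc m)\<bar>)"
        using x_m x_Suc False V V0 by (intro mult_left_mono D) auto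
      finally show ?thesis .
    next
      assume "l1_norm (s - 1) x \<le> ?D * (?V - \<bar>x m\<bar>)"
      then have "l1_norm m x \<le> ?D * ?V"
        using block by (simp add: algebra_simps)
      also have "\<dots> \<le> ?D * (total_variation (Suc m) x - \<bar>x (Suc m)\<bar>)"
        using x_m x_Suc False V by (intro mult_left_mono D) auto
      finally show ?thesis .
    qed
    then show ?thesis by (intro exI[of _ "Suc m"]) auto
  qed
qed

theorem mainTheorem5:
  fixes n :: nat and x :: "nat \<Rightarrow> real"
  assumes "\<And>i. i \<in> {1..n} \<Longrightarrow> x i \<in> {-1, 0, 1}"
    and "total_variation n x > 0"
  shows "l1_norm n x \<le> discrepancy_norm n x * total_variation n x"
proof -
  have n: "n \<ge> 1"
    using assms(2) by (cases n) (auto simp: total_variation_def)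
  obtain s where s: "1 \<le> s" "s \<le> n" "\<And>i. i \<in> {s..n} \<Longrightarrow> x i = x n"
    and bound: "s = 1 \<or>
      l1_norm (s - 1) x \<le> discrepancy_norm n x * (total_variation n x - \<bar>x n\<bar>)"
    using last_block_l1_bound[OF n order_refl, of x] assms(1) by blast
  \<comment> \<open>Otherwise the whole vector would be a single constant block, with zero
    variation.\<close>
  have "s \<noteq> 1"
    using total_variation_const[of n x "x n"] s(3) assms(2) by (metis less_irrefl)
  moreover have "l1_norm n x \<le> l1_norm (s - 1) x + discrepancy_norm n x * \<bar>x n\<bar>"
    using n by (intro l1_norm_const_block s assms(1)) auto
  \<comment> \<open>The last block spends exactly the reserve
    \<open>\<bar>x n\<bar>\<close>.\<close>
  ultimately show ?thesis
    using bound by (simp add: algebra_simps)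
qed

end
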